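(* Let $n\ge1$ be an integer, let $a<b$ be real numbers, let $p$ be a real polynomial of degree $n$ with leading coefficient $1/n!$, and let $1\le r,s\le\infty$ with $1/r+1/s=1$. For every $f:[a,b]\to\mathbb{R}$ such that $f^{(n-1)}$ is absolutely continuous and $f^{(n)}\in L^s([a,b])$, $$\left|E_{(a,b)}(p,f)\right|\le (b-a)^{n+1/r}\,\|p\|_r\,\|f^{(n)}\|_s,$$ and this bound is sharp: the constant $(b-a)^{n+1/r}\|p\|_r$ cannot be replaced by any smaller number $C$ (depending on $a,b,n,p,r$ but not on $f$) such that $|E_{(a,b)}(p,f)|\le C\|f^{(n)}\|_s$ for all such $f$.
   Context: The error term is $$E_{(a,b)}(p,f)=(-1)^n(b-a)^{n+1}\int_0^1 p(x)f^{(n)}\big(a+(b-a)x\big)\,dx.$$ The norms are $\|p\|_r=\left(\int_0^1|p(x)|^r\,dx\right)^{1/r}$ for $r<\infty$, $\|p\|_\infty=\max_{x\in[0,1]}|p(x)|$, $\|f^{(n)}\|_s=\left(\int_a^b|f^{(n)}(x)|^s\,dx\right)^{1/s}$ for $s<\infty$, and $\|f^{(n)}\|_\infty$ is the (essential) supremum of $|f^{(n)}|$ on $[a,b]$. The convention $1/\infty=0$ is used. *)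

theory Defs
  imports "HOL-Analysis.Analysis" "HOL-Probability.Essential_Supremum"
begin

text \<open>
  Functions on \<open>[a, b]\<close> are total functions of which only the values on \<open>{a..b}\<close> matter:
  all derivatives are taken within \<open>{a..b}\<close>, so they are one-sided at the endpoints.
\<close>

primrec nth_deriv_within :: "real set \<Rightarrow> nat \<Rightarrow> (real \<Rightarrow> real) \<Rightarrow> real \<Rightarrow> real" where
  "nth_deriv_within S 0 f = f"
| "nth_deriv_within S (Suc k) f =
     (\<lambda>x. vector_derivative (nth_deriv_within S k f) (at x within S))"

text \<open>
  A finite set \<open>I\<close> of pairs encodes a finite family of subintervals with pairwise disjoint
  interiors; degenerate intervals contribute nothing to either sum.
\<close>

definition abs_continuous_on_interval :: "real \<Rightarrow> real \<Rightarrow> (real \<Rightarrow> real) \<Rightarrow> bool" where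
  "abs_continuous_on_interval a b g \<longleftrightarrow>
     (\<forall>\<epsilon>>0. \<exists>\<delta>>0. \<forall>I :: (real \<times> real) set.
        finite I \<longrightarrow>
        (\<forall>(u, v)\<in>I. a \<le> u \<and> u \<le> v \<and> v \<le> b) \<longrightarrow>
        disjoint_family_on (\<lambda>(u, v). {u<..<v}) I \<longrightarrow>
        (\<Sum>(u, v)\<in>I. v - u) < \<delta> \<longrightarrow>
        (\<Sum>(u, v)\<in>I. \<bar>g v - g u\<bar>) < \<epsilon>)"

text \<open>
  Exponents are extended reals in \<open>[1, \<infinity>]\<close>.
\<close>

definition in_Lp :: "ereal \<Rightarrow> real \<Rightarrow> real \<Rightarrow> (real \<Rightarrow> real) \<Rightarrow> bool" where
  "in_Lp s a b g \<longleftrightarrow>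
     g \<in> borel_measurable (lebesgue_on {a..b}) \<and>
     (if s = \<infinity> then esssup (lebesgue_on {a..b}) (\<lambda>x. ereal \<bar>g x\<bar>) < \<infinity>
      else integrable (lebesgue_on {a..b}) (\<lambda>x. \<bar>g x\<bar> powr real_of_ereal s))"

definition Lp_norm :: "ereal \<Rightarrow> real \<Rightarrow> real \<Rightarrow> (real \<Rightarrow> real) \<Rightarrow> real" where
  "Lp_norm s a b g =
     (if s = \<infinity> then real_of_ereal (esssup (lebesgue_on {a..b}) (\<lambda>x. ereal \<bar>g x\<bar>))
      else (LINT x|lebesgue_on {a..b}. \<bar>g x\<bar> powr real_of_ereal s)
             powr (1 / real_of_ereal s))"

text \<open>
  The supremum below is the maximum of a continuous function on a compact interval.
\<close>

definition poly_norm :: "ereal \<Rightarrow> real poly \<Rightarrow> real" where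
  "poly_norm r p =
     (if r = \<infinity> then (SUP x\<in>{0..1}. \<bar>poly p x\<bar>)
      else (LINT x|lebesgue_on {0..1}. \<bar>poly p x\<bar> powr real_of_ereal r)
             powr (1 / real_of_ereal r))"

text \<open>
  \<open>f\<close> is \<open>n - 1\<close> times differentiable on \<open>[a, b]\<close>, its derivative of order \<open>n - 1\<close> is absolutely
  continuous, and its \<open>n\<close>-th derivative lies in \<open>L\<^sup>s\<close>.  The \<open>n\<close>-th derivative then exists
  only almost everywhere; the value \<^const>\<open>vector_derivative\<close> takes on the exceptional null
  set affects neither membership, norms nor integrals with respect to Lebesgue measure.
\<close>

definition admissible :: "nat \<Rightarrow> ereal \<Rightarrow> real \<Rightarrow> real \<Rightarrow> (real \<Rightarrow> real) \<Rightarrow> bool" where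
  "admissible n s a b f \<longleftrightarrow>
     (\<forall>k < n - 1. nth_deriv_within {a..b} k f differentiable_on {a..b}) \<and>
     abs_continuous_on_interval a b (nth_deriv_within {a..b} (n - 1) f) \<and>
     in_Lp s a b (nth_deriv_within {a..b} n f)"

definition error_term ::
  "nat \<Rightarrow> real \<Rightarrow> real \<Rightarrow> real poly \<Rightarrow> (real \<Rightarrow> real) \<Rightarrow> real" where
  "error_term n a b p f =
     (-1) ^ n * (b - a) ^ (n + 1) *
     (LINT x|lebesgue_on {0..1}. poly p x * nth_deriv_within {a..b} n f (a + (b - a) * x))"

end

theory Submission
  imports Defs
begin

text \<open>
  The substitution \<open>y = a + (b - a) x\<close> moves everything to \<open>[0, 1]\<close>, where the bound is Hoelder's
  inequality.  For sharpness, every continuous \<open>h\<close> on \<open>[0, 1]\<close> is a rescaled \<open>n\<close>-th derivative of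
  an admissible function, so it suffices to find continuous (almost) extremisers of Hoelder's
  inequality: \<open>sgn p \<bar>p\<bar>\<^sup>r\<^sup>-\<^sup>1\<close> if \<open>1 < r < \<infinity>\<close>, the smoothed sign \<open>p / (\<bar>p\<bar> + e)\<close> if \<open>r = 1\<close>,
  and a bump around a near-maximum point of \<open>\<bar>p\<bar>\<close> if \<open>r = \<infinity>\<close>.
\<close>

section \<open>Affine change of variables between \<open>{0..1}\<close> and
  \<open>{a..b}\<close>\<close>

text \<open>Writing the measure as a push-forward with constant density lets integrals,
  integrability and almost-everywhere statements all be transported by the general rules for
  \<open>density\<close> and \<open>distr\<close>. It is the scaling law of Lebesgue measure on the
  whole line, restricted.\<close>

lemma lebesgue_on_affine:
  fixes a b :: real
  assumes "a < b"
  shows "(\<lambda>x. a + (b - a) * x) \<in> lebesgue_on {0..1} \<rightarrow>\<^sub>M lebesgue_on {a..b}" (is ?meas)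
    and "lebesgue_on {a..b} = density (distr (lebesgue_on {0..1}) (lebesgue_on {a..b})
           (\<lambda>x. a + (b - a) * x)) (\<lambda>_. ennreal (b - a))" (is ?eq)
proof -
  define \<phi> where "\<phi> = (\<lambda>x. a + (b - a) * x)"
  have range: "\<phi> x \<in> {a..b} \<longleftrightarrow> x \<in> {0..1}" for x
  proof -
    have "(b - a) * x \<le> (b - a) * 1 \<longleftrightarrow> x \<le> 1"
      using assms by (intro mult_le_cancel_left_pos) auto
    moreover have "0 \<le> (b - a) * x \<longleftrightarrow> 0 \<le> x"
      using assms by (simp add: zero_le_mult_iff)
    ultimately show ?thesis
      unfolding \<phi>_def by auto
  qed
  have \<phi>: "\<phi> \<in> lebesgue \<rightarrow>\<^sub>M lebesgue"
    using lebesgue_affine_measurable[of "\<lambda>_. b - a" a] assms by (simp add: \<phi>_def)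
  have meas: "\<phi> \<in> lebesgue_on {0..1} \<rightarrow>\<^sub>M lebesgue_on {a..b}"
    using range by (intro measurable_restrict_space3 \<phi>) auto
  then show ?meas
    by (simp add: \<phi>_def)
  have "lebesgue_on {a..b} =
      density (distr (lebesgue_on {0..1}) (lebesgue_on {a..b}) \<phi>) (\<lambda>_. ennreal (b - a))"
  proof (rule measure_eqI)
    fix A assume A: "A \<in> sets (lebesgue_on {a..b})"
    then have A': "A \<subseteq> {a..b}" "A \<in> sets lebesgue"
      by (auto simp: sets_restrict_space_iff)
    \<comment> \<open>The preimage already lies in the unit interval, so restricting the measure
      there does not change its mass.\<close>
    have sub: "\<phi> -` A \<subseteq> {0..1}"
      using A' range by blast
    have lb: "lebesgue = density (distr lebesgue lebesgue \<phi>) (\<lambda>_. ennreal (b - a))"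
      using lebesgue_real_affine[of "b - a" a] assms by (simp add: \<phi>_def)
    have "emeasure (lebesgue_on {a..b}) A = emeasure lebesgue A"
      using A' by (simp add: emeasure_restrict_space)
    also have "\<dots> = emeasure (density (distr lebesgue lebesgue \<phi>) (\<lambda>_. ennreal (b - a))) A"
      by (subst lb) simp
    also have "\<dots> = (b - a) * emeasure lebesgue (\<phi> -` A)"
      using A' \<phi> by (simp add: emeasure_density nn_integral_cmult emeasure_distr)
    also have "\<dots> = (b - a) * emeasure (lebesgue_on {0..1}) (\<phi> -` A \<inter> {0..1})"
      using sub by (simp add: emeasure_restrict_space Int_absorb2)
    also have "\<dots> = emeasure
        (density (distr (lebesgue_on {0..1}) (lebesgue_on {a..b}) \<phi>) (\<lambda>_. ennreal (b - a))) A"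
      using A meas by (simp add: emeasure_density nn_integral_cmult emeasure_distr)
    finally show "emeasure (lebesgue_on {a..b}) A = \<dots>" .
  qed simp
  then show ?eq
    by (simp add: \<phi>_def)
qed

lemma
  fixes g :: "real \<Rightarrow> real"
  assumes "a < b" and g: "g \<in> borel_measurable (lebesgue_on {a..b})"
  shows integral_lebesgue_on_affine:
      "(LINT x|lebesgue_on {a..b}. g x) = (b - a) * (LINT x|lebesgue_on {0..1}. g (a + (b - a) * x))"
    and integrable_lebesgue_on_affine:
      "integrable (lebesgue_on {a..b}) g \<longleftrightarrow>
       integrable (lebesgue_on {0..1}) (\<lambda>x. g (a + (b - a) * x))"
  using assms lebesgue_on_affine(1)[OF \<open>a < b\<close>]
  by (subst lebesgue_on_affine(2)[OF \<open>a < b\<close>],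
      simp add: integral_density integrable_density integral_distr integrable_distr_eq)+

text \<open>An essential supremum is determined by which constants bound the function almost
  everywhere, and null sets correspond under the substitution because the density
  \<open>b - a\<close> is a positive constant.\<close>

lemma esssup_lebesgue_on_affine:
  fixes g :: "real \<Rightarrow> ereal"
  assumes "a < b" and g: "g \<in> borel_measurable (lebesgue_on {a..b})"
  shows "esssup (lebesgue_on {a..b}) g = esssup (lebesgue_on {0..1}) (\<lambda>x. g (a + (b - a) * x))"
proof -
  note \<phi> = lebesgue_on_affine(1)[OF \<open>a < b\<close>]
  have "(AE x in lebesgue_on {a..b}. g x \<le> z) \<longleftrightarrow>
      (AE x in lebesgue_on {0..1}. g (a + (b - a) * x) \<le> z)" for z
  proof -
    have m: "{x \<in> space (lebesgue_on {a..b}). g x \<le> z} \<in> sets (lebesgue_on {a..b})"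
      using g by measurable
    show ?thesis
      using \<open>a < b\<close> AE_distr_iff[OF \<phi> m]
      by (subst lebesgue_on_affine(2)[OF \<open>a < b\<close>]) (simp add: AE_density)
  qed
  then show ?thesis
    using esssup_eq_AE[OF g] esssup_eq_AE[OF measurable_compose[OF \<phi> g]] by simp
qed

text \<open>The Jacobian \<open>b - a\<close> comes out of the integral and is raised to the power
  \<open>1 / s\<close>. For \<open>s = \<infinity>\<close> this exponent is 0 and the factor is 1,
  matching the invariance of the essential supremum.\<close>

lemma
  assumes "a < b" and "1 \<le> s" and g: "g \<in> borel_measurable (lebesgue_on {a..b})"
  shows Lp_norm_affine:
      "Lp_norm s a b g =
        (b - a) powr real_of_ereal (1 / s) * Lp_norm s 0 1 (\<lambda>x. g (a + (b - a) * x))"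
    and in_Lp_affine: "in_Lp s a b g \<longleftrightarrow> in_Lp s 0 1 (\<lambda>x. g (a + (b - a) * x))"
proof -
  note \<phi> = measurable_compose[OF lebesgue_on_affine(1)[OF \<open>a < b\<close>] g]
  note e = esssup_lebesgue_on_affine[OF \<open>a < b\<close>, of "\<lambda>x. ereal \<bar>g x\<bar>"]
  have p: "(\<lambda>x. \<bar>g x\<bar> powr t) \<in> borel_measurable (lebesgue_on {a..b})" for t
    using g by measurable
  show "in_Lp s a b g \<longleftrightarrow> in_Lp s 0 1 (\<lambda>x. g (a + (b - a) * x))"
    using g \<phi> e integrable_lebesgue_on_affine[OF \<open>a < b\<close> p, of "real_of_ereal s"]
    by (auto simp: in_Lp_def)
  show "Lp_norm s a b g =
        (b - a) powr real_of_ereal (1 / s) * Lp_norm s 0 1 (\<lambda>x. g (a + (b - a) * x))"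
  proof (cases s)
    case (real t)
    then show ?thesis
      using integral_lebesgue_on_affine[OF \<open>a < b\<close> p, of t] \<open>a < b\<close> \<open>1 \<le> s\<close>
      by (simp add: Lp_norm_def powr_mult one_ereal_def)
  qed (use \<open>1 \<le> s\<close> e g \<open>a < b\<close> in \<open>auto simp: Lp_norm_def\<close>)
qed

section \<open>Hoelder's inequality, including the endpoint exponents\<close>

text \<open>Divide \<open>f\<close> and \<open>g\<close> by their norms \<open>A\<close> and
  \<open>B\<close>, apply Young's inequality pointwise and integrate: the right-hand side becomes
  \<open>A * B * (1 / p + 1 / q)\<close>. If a norm is 0, the normalisation fails, but then the
  product vanishes almost everywhere.\<close>

lemma Holder_integral_inequality:
  fixes f g :: "'a \<Rightarrow> real"
  assumes pq: "p > 1" "q > 1" "1 / p + 1 / q = 1"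
    and [measurable]: "f \<in> borel_measurable M" "g \<in> borel_measurable M"
    and f: "integrable M (\<lambda>x. \<bar>f x\<bar> powr p)" and g: "integrable M (\<lambda>x. \<bar>g x\<bar> powr q)"
  shows "\<bar>LINT x|M. f x * g x\<bar> \<le>
    (LINT x|M. \<bar>f x\<bar> powr p) powr (1 / p) * (LINT x|M. \<bar>g x\<bar> powr q) powr (1 / q)"
proof -
  define F G where "F = (LINT x|M. \<bar>f x\<bar> powr p)" and "G = (LINT x|M. \<bar>g x\<bar> powr q)"
  define A B where "A = F powr (1 / p)" and "B = G powr (1 / q)"
  have nn: "F \<ge> 0" "G \<ge> 0"
    by (simp_all add: F_def G_def)
  show ?thesis
  proof (cases "F = 0 \<or> G = 0")
    case True
    then have "AE x in M. f x * g x = 0"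
    proof
      assume "F = 0"
      then have "AE x in M. \<bar>f x\<bar> powr p = 0"
        unfolding F_def by (subst (asm) integral_nonneg_eq_0_iff_AE[OF f]) auto
      then show ?thesis by auto
    next
      assume "G = 0"
      then have "AE x in M. \<bar>g x\<bar> powr q = 0"
        unfolding G_def by (subst (asm) integral_nonneg_eq_0_iff_AE[OF g]) auto
      then show ?thesis by auto
    qed
    then have "(LINT x|M. f x * g x) = 0"
      by (rule integral_eq_zero_AE)
    then show ?thesis
      by simp
  next
    case False
    then have pos: "F > 0" "G > 0" "A > 0" "B > 0"
      using nn by (auto simp: A_def B_def)
    have AB: "A powr p = F" "B powr q = G"
      using pq pos by (simp_all add: A_def B_def powr_powr)
    have young: "\<bar>f x * g x\<bar> \<le> A * B * (\<bar>f x\<bar> powr p / (p * F) + \<bar>g x\<bar> powr q / (q * G))" for x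
    proof -
      have "\<bar>f x\<bar> / A * (\<bar>g x\<bar> / B) \<le> (\<bar>f x\<bar> / A) powr p / p + (\<bar>g x\<bar> / B) powr q / q"
        using pq pos by (intro Youngs_inequality) auto
      then have "A * B * (\<bar>f x\<bar> / A * (\<bar>g x\<bar> / B)) \<le>
          A * B * ((\<bar>f x\<bar> / A) powr p / p + (\<bar>g x\<bar> / B) powr q / q)"
        using pos by (intro mult_left_mono) auto
      moreover have "A * B * (\<bar>f x\<bar> / A * (\<bar>g x\<bar> / B)) = \<bar>f x * g x\<bar>"
        using pos by (simp add: abs_mult)
      moreover have "(\<bar>f x\<bar> / A) powr p / p = \<bar>f x\<bar> powr p / (p * F)"
        "(\<bar>g x\<bar> / B) powr q / q = \<bar>g x\<bar> powr q / (q * G)"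
        using pos by (simp_all add: powr_divide AB mult.commute)
      ultimately show ?thesis
        by simp
    qed
    have int: "integrable M (\<lambda>x. A * B * (\<bar>f x\<bar> powr p / (p * F) + \<bar>g x\<bar> powr q / (q * G)))"
      using f g by auto
    \<comment> \<open>Integrability of the product is not assumed; the Young majorant provides
      it.\<close>
    have "integrable M (\<lambda>x. f x * g x)"
      using young by (intro Bochner_Integration.integrable_bound[OF int] AE_I2)
        (auto intro: order_trans[OF _ abs_ge_self])
    then have "(LINT x|M. \<bar>f x * g x\<bar>) \<le>
        (LINT x|M. A * B * (\<bar>f x\<bar> powr p / (p * F) + \<bar>g x\<bar> powr q / (q * G)))"
      by (intro integral_mono[OF integrable_abs int] young)
    then have "\<bar>LINT x|M. f x * g x\<bar> \<le>
        (LINT x|M. A * B * (\<bar>f x\<bar> powr p / (p * F) + \<bar>g x\<bar> powr q / (q * G)))"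
      by (rule order_trans[OF integral_abs_bound])
    also have "\<dots> = A * B * (F / (p * F) + G / (q * G))"
      using f g by (simp add: F_def G_def)
    also have "\<dots> = A * B"
      using pq pos by simp
    finally show ?thesis
      by (simp add: A_def B_def F_def G_def)
  qed
qed

text \<open>If both exponents are finite, neither can be 1, since the reciprocal of the other would
  have to be 0. So the two endpoint pairs split off from the range where Young's inequality
  applies.\<close>

lemma conjugate_exponents_cases:
  fixes r s :: ereal
  assumes "1 \<le> r" "1 \<le> s" "1 / r + 1 / s = 1"
  obtains (infinity_one) "r = \<infinity>" "s = 1"
    | (one_infinity) "r = 1" "s = \<infinity>"
    | (real) r' s' where "r = ereal r'" "s = ereal s'" "r' > 1" "s' > 1" "1 / r' + 1 / s' = 1"
proof (cases r; cases s)
  fix r' s' assume *: "r = ereal r'" "s = ereal s'"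
  then have "1 / r' + 1 / s' = 1" "r' \<ge> 1" "s' \<ge> 1"
    using assms by (auto simp: one_ereal_def divide_ereal_def inverse_eq_divide)
  moreover from this have "r' \<noteq> 1" "s' \<noteq> 1"
    by auto
  ultimately show ?thesis
    using real * by force
next
  fix r' assume *: "r = ereal r'" "s = \<infinity>"
  then show ?thesis
    using assms one_infinity by (auto simp: one_ereal_def field_simps split: if_splits)
next
  fix s' assume *: "r = \<infinity>" "s = ereal s'"
  then show ?thesis
    using assms infinity_one by (auto simp: one_ereal_def field_simps split: if_splits)
qed (use assms in auto)

lemma borel_measurable_poly_lebesgue_on [measurable]:
  "poly (p :: real poly) \<in> borel_measurable (lebesgue_on {u..v})"
  by (intro continuous_imp_measurable_on_sets_lebesgue continuous_intros) auto

lemma poly_abs_le_poly_norm_infinity: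
  assumes "x \<in> {0..1}"
  shows "\<bar>poly p x\<bar> \<le> poly_norm \<infinity> p"
proof -
  have "bdd_above ((\<lambda>x. \<bar>poly p x\<bar>) ` {0..1::real})"
    by (intro compact_imp_bounded bounded_imp_bdd_above compact_continuous_image continuous_intros)
       auto
  then show ?thesis
    using assms by (auto simp: poly_norm_def intro: cSUP_upper)
qed

text \<open>At the endpoint exponents the factor measured in the supremum norm is pulled out of the
  integral; the remaining case is the classical inequality.\<close>

lemma poly_norm_Holder:
  assumes rs: "1 \<le> r" "1 \<le> s" "1 / r + 1 / s = 1" and h: "in_Lp s 0 1 h"
  shows "\<bar>LINT x|lebesgue_on {0..1}. poly p x * h x\<bar> \<le> poly_norm r p * Lp_norm s 0 1 h"
proof -
  have hm [measurable]: "h \<in> borel_measurable (lebesgue_on {0..1})"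
    using h by (simp add: in_Lp_def)
  \<comment> \<open>Both endpoint cases reduce to finding an integrable majorant
    \<open>w\<close>.\<close>
  have bound: "\<bar>LINT x|lebesgue_on {0..1}. poly p x * h x\<bar> \<le> (LINT x|lebesgue_on {0..1}. w x)"
    if w: "integrable (lebesgue_on {0..1}) w"
      and le: "AE x in lebesgue_on {0..1}. \<bar>poly p x * h x\<bar> \<le> w x" for w
  proof -
    have "integrable (lebesgue_on {0..1}) (\<lambda>x. poly p x * h x)"
      using le by (intro Bochner_Integration.integrable_bound[OF w])
        (auto elim!: eventually_mono intro: order_trans[OF _ abs_ge_self])
    then show ?thesis
      using integral_mono_AE[OF integrable_abs w le]
        integral_abs_bound[of "lebesgue_on {0..1}" "\<lambda>x. poly p x * h x"] by linarith
  qed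
  show ?thesis
    using rs
  proof (cases rule: conjugate_exponents_cases)
    case infinity_one
    have "integrable (lebesgue_on {0..1}) (\<lambda>x. poly_norm r p * \<bar>h x\<bar>)"
      using h infinity_one by (simp add: in_Lp_def)
    moreover have "AE x in lebesgue_on {0..1}. \<bar>poly p x * h x\<bar> \<le> poly_norm r p * \<bar>h x\<bar>"
      using poly_abs_le_poly_norm_infinity[of _ p] infinity_one
      by (intro AE_I2) (auto simp: abs_mult intro: mult_right_mono)
    ultimately show ?thesis
      using bound[of "\<lambda>x. poly_norm r p * \<bar>h x\<bar>"] infinity_one by (simp add: Lp_norm_def)
  next
    case one_infinity
    define N where "N = Lp_norm s 0 1 h"
    \<comment> \<open>Comparison with 0 excludes the value minus infinity and \<open>in_Lp\<close>
      excludes plus infinity, so \<open>real_of_ereal\<close> in \<open>Lp_norm\<close> loses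
      nothing.\<close>
    have "esssup (lebesgue_on {0..1::real}) (\<lambda>x. 0::ereal) \<le>
        esssup (lebesgue_on {0..1}) (\<lambda>x. ereal \<bar>h x\<bar>)"
      by (rule esssup_mono) simp_all
    then have "0 \<le> esssup (lebesgue_on {0..1}) (\<lambda>x. ereal \<bar>h x\<bar>)"
      by (subst (asm) esssup_const) (simp_all add: emeasure_restrict_space)
    then have N: "esssup (lebesgue_on {0..1}) (\<lambda>x. ereal \<bar>h x\<bar>) = ereal N"
      using h one_infinity by (auto simp: N_def Lp_norm_def in_Lp_def ereal_real')
    have ae: "AE x in lebesgue_on {0..1}. \<bar>poly p x * h x\<bar> \<le> N * \<bar>poly p x\<bar>"
      using esssup_AE[of "\<lambda>x. ereal \<bar>h x\<bar>" "lebesgue_on {0..1}"] unfolding N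
      by eventually_elim (auto simp: abs_mult mult.commute intro: mult_right_mono)
    have "integrable (lebesgue_on {0..1}) (\<lambda>x. N * \<bar>poly p x\<bar>)"
      by (intro continuous_imp_integrable_real continuous_intros)
    from bound[OF this ae] show ?thesis
      using one_infinity by (simp add: poly_norm_def N_def mult.commute)
  next
    case (real r' s')
    have "integrable (lebesgue_on {0..1}) (\<lambda>x. \<bar>poly p x\<bar> powr r')"
      using real by (intro continuous_imp_integrable_real continuous_on_powr' continuous_intros) auto
    then show ?thesis
      using Holder_integral_inequality[of r' s' "poly p" "lebesgue_on {0..1}" h] real h
      by (simp add: poly_norm_def Lp_norm_def in_Lp_def)
  qed
qed


section \<open>Norms depend only on values on the interval; integrals of continuous
  functions\<close>

text \<open>\<open>esssup\<close> tests measurability before taking a \<open>Limsup\<close> along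
  the almost-everywhere filter, so both ingredients have to be compared.\<close>

lemma esssup_abs_cong:
  fixes f g :: "real \<Rightarrow> real"
  assumes "\<And>x. x \<in> {a..b} \<Longrightarrow> f x = g x"
  shows "esssup (lebesgue_on {a..b}) (\<lambda>x. ereal \<bar>f x\<bar>) =
         esssup (lebesgue_on {a..b}) (\<lambda>x. ereal \<bar>g x\<bar>)"
proof -
  have "(\<lambda>x. ereal \<bar>f x\<bar>) \<in> borel_measurable (lebesgue_on {a..b}) \<longleftrightarrow>
        (\<lambda>x. ereal \<bar>g x\<bar>) \<in> borel_measurable (lebesgue_on {a..b})"
    using assms by (intro measurable_cong) simp
  moreover have "Limsup (ae_filter (lebesgue_on {a..b})) (\<lambda>x. ereal \<bar>f x\<bar>) =
      Limsup (ae_filter (lebesgue_on {a..b})) (\<lambda>x. ereal \<bar>g x\<bar>)"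
    using assms by (intro Limsup_eq AE_I2) simp
  ultimately show ?thesis
    by (simp add: esssup_def)
qed

lemma
  assumes fg: "\<And>x. x \<in> {a..b} \<Longrightarrow> f x = g x"
  shows Lp_norm_cong: "Lp_norm s a b f = Lp_norm s a b g"
    and in_Lp_cong: "in_Lp s a b f \<longleftrightarrow> in_Lp s a b g"
proof -
  have "(LINT x|lebesgue_on {a..b}. \<bar>f x\<bar> powr t) = (LINT x|lebesgue_on {a..b}. \<bar>g x\<bar> powr t)"
    "integrable (lebesgue_on {a..b}) (\<lambda>x. \<bar>f x\<bar> powr t) \<longleftrightarrow>
     integrable (lebesgue_on {a..b}) (\<lambda>x. \<bar>g x\<bar> powr t)" for t
    using fg by (auto intro!: Bochner_Integration.integral_cong Bochner_Integration.integrable_cong)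
  moreover have "f \<in> borel_measurable (lebesgue_on {a..b}) \<longleftrightarrow>
      g \<in> borel_measurable (lebesgue_on {a..b})"
    using fg by (intro measurable_cong) simp
  ultimately show "Lp_norm s a b f = Lp_norm s a b g" "in_Lp s a b f \<longleftrightarrow> in_Lp s a b g"
    using esssup_abs_cong[OF fg] by (auto simp: Lp_norm_def in_Lp_def)
qed

lemma continuous_on_imp_in_Lp:
  assumes g: "continuous_on {a..b} g" and "1 \<le> s"
  shows "in_Lp s a b g"
proof -
  have m [measurable]: "g \<in> borel_measurable (lebesgue_on {a..b})"
    using g by (intro continuous_imp_measurable_on_sets_lebesgue) auto
  show ?thesis
  proof (cases s)
    case (real t)
    then have "integrable (lebesgue_on {a..b}) (\<lambda>x. \<bar>g x\<bar> powr t)"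
      using \<open>1 \<le> s\<close>
      by (intro continuous_imp_integrable_real continuous_on_powr' continuous_intros g)
        (auto simp: one_ereal_def)
    then show ?thesis
      using real m by (simp add: in_Lp_def)
  next
    case PInf
    obtain B where B: "\<And>x. x \<in> {a..b} \<Longrightarrow> \<bar>g x\<bar> \<le> B"
      using compact_imp_bounded[OF compact_continuous_image[OF g]]
      unfolding bounded_iff by (metis compact_Icc imageI real_norm_def)
    have "esssup (lebesgue_on {a..b}) (\<lambda>x. ereal \<bar>g x\<bar>) \<le> ereal B"
      using B by (intro esssup_I AE_I2) auto
    then show ?thesis
      using PInf m by (auto simp: in_Lp_def intro: le_less_trans)
  qed (use \<open>1 \<le> s\<close> in auto)
qed

lemma Lp_norm_one:
  assumes "1 \<le> s"
  shows "Lp_norm s 0 1 (\<lambda>_. 1) = 1"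
  using assms
  by (cases s) (auto simp: Lp_norm_def esssup_const emeasure_restrict_space
      measure_restrict_space one_ereal_def)

text \<open>A continuous nonnegative function with zero integral vanishes identically, which the
  point \<open>x0\<close> excludes.\<close>

lemma integral_lebesgue_on_pos:
  fixes w :: "real \<Rightarrow> real"
  assumes w: "continuous_on {a..b} w" "\<And>x. x \<in> {a..b} \<Longrightarrow> w x \<ge> 0"
    and "a < b" "x0 \<in> {a..b}" "w x0 > 0"
  shows "(LINT x|lebesgue_on {a..b}. w x) > 0"
proof -
  have "integral {a..b} w \<noteq> 0"
    using integral_eq_0_iff[OF w(1) \<open>a < b\<close>] w assms(4,5) by force
  moreover have "integral {a..b} w \<ge> 0"
    using w by (intro Henstock_Kurzweil_Integration.integral_nonneg integrable_continuous_real) auto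
  ultimately show ?thesis
    using lebesgue_integral_eq_integral[OF continuous_imp_integrable_real[OF w(1)]] by simp
qed

section \<open>Continuous near-extremisers of Hoelder's inequality\<close>

text \<open>Mass concentrated where \<open>\<bar>poly p x\<bar>\<close> exceeds \<open>c\<close>,
  with the sign of \<open>p\<close> there, gives an integral above \<open>c\<close> times the
  mass.\<close>

lemma poly_norm_sharp_infinity:
  assumes "0 \<le> c" "c < poly_norm \<infinity> p"
  shows "\<exists>h. continuous_on UNIV h \<and>
    c * Lp_norm 1 0 1 h < (LINT x|lebesgue_on {0..1}. poly p x * h x)"
proof -
  have "\<exists>x0\<in>{0..1}. c < \<bar>poly p x0\<bar>"
  proof (rule ccontr)
    assume "\<not> ?thesis"
    then have "(SUP x\<in>{0..1}. \<bar>poly p x\<bar>) \<le> c"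
      by (intro cSUP_least) (auto simp: not_less)
    then show False
      using assms by (simp add: poly_norm_def)
  qed
  then obtain x0 where x0: "x0 \<in> {0..1}" "c < \<bar>poly p x0\<bar>"
    by blast
  define \<sigma> where "\<sigma> = sgn (poly p x0)"
  have \<sigma>: "\<bar>\<sigma>\<bar> = 1"
    using x0 \<open>0 \<le> c\<close> by (auto simp: \<sigma>_def sgn_if)
  have pos: "c < \<sigma> * poly p x0"
    using x0 by (simp add: \<sigma>_def abs_sgn mult.commute)
  have "isCont (\<lambda>x. \<sigma> * poly p x) x0"
    by (intro continuous_intros)
  then have "\<forall>\<^sub>F x in at x0. c < \<sigma> * poly p x"
    using pos by (simp add: isCont_def order_tendstoD)
  then obtain d where d: "d > 0" "\<And>x. x \<noteq> x0 \<Longrightarrow> \<bar>x - x0\<bar> < d \<Longrightarrow> c < \<sigma> * poly p x"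
    by (auto simp: eventually_at dist_real_def)
  \<comment> \<open>A tent that vanishes outside the neighbourhood where
    \<open>\<sigma> * poly p x\<close> exceeds \<open>c\<close>. If \<open>x0\<close> is an endpoint
    of \<open>{0..1}\<close>, the half tent inside still has positive integral.\<close>
  define k where "k = (\<lambda>x. max 0 (d - \<bar>x - x0\<bar>))"
  have k: "continuous_on S k" for S
    unfolding k_def by (intro continuous_intros)
  have norm: "Lp_norm 1 0 1 (\<lambda>x. \<sigma> * k x) = (LINT x|lebesgue_on {0..1}. k x)"
    by (simp add: Lp_norm_def abs_mult \<sigma> k_def)
  have "(LINT x|lebesgue_on {0..1}. (\<sigma> * poly p x - c) * k x) > 0"
  proof (rule integral_lebesgue_on_pos)
    show "(\<sigma> * poly p x - c) * k x \<ge> 0" if "x \<in> {0..1}" for x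
    proof (cases "\<bar>x - x0\<bar> < d")
      case True
      then have "c < \<sigma> * poly p x"
        using d pos by (cases "x = x0") auto
      then show ?thesis
        by (simp add: k_def)
    qed (simp add: k_def)
  qed (use x0 d pos in \<open>auto intro!: continuous_intros k simp: k_def\<close>)
  also have "(LINT x|lebesgue_on {0..1}. (\<sigma> * poly p x - c) * k x) =
      (LINT x|lebesgue_on {0..1}. poly p x * (\<sigma> * k x) - c * k x)"
    by (simp add: algebra_simps)
  also have "\<dots> = (LINT x|lebesgue_on {0..1}. poly p x * (\<sigma> * k x)) -
      (LINT x|lebesgue_on {0..1}. c * k x)"
    by (intro Bochner_Integration.integral_diff continuous_imp_integrable_real continuous_intros k)
  finally show ?thesis
    using norm by (intro exI[of _ "\<lambda>x. \<sigma> * k x"]) (auto intro!: continuous_intros k)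
qed

text \<open>The extremiser, the sign of \<open>p\<close>, need not be continuous. Its smoothing
  \<open>h\<close> stays bounded by 1, and \<open>poly p x * h x\<close> falls short of
  \<open>\<bar>poly p x\<bar>\<close> by at most \<open>e\<close>.\<close>

lemma poly_norm_sharp_one:
  assumes "0 \<le> c" "c < poly_norm 1 p"
  shows "\<exists>h. continuous_on UNIV h \<and>
    c * Lp_norm \<infinity> 0 1 h < (LINT x|lebesgue_on {0..1}. poly p x * h x)"
proof -
  \<comment> \<open>Half the gap: the loss of \<open>e\<close> over the unit interval keeps the
    integral above \<open>c\<close>.\<close>
  define e where "e = (poly_norm 1 p - c) / 2"
  have e: "e > 0" "c < poly_norm 1 p - e"
    using assms by (auto simp: e_def field_simps)
  define h where "h = (\<lambda>x. poly p x / (\<bar>poly p x\<bar> + e))"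
  have h: "continuous_on S h" for S
    unfolding h_def using e by (intro continuous_intros) (auto simp: add_nonneg_eq_0_iff)
  have "\<bar>h x\<bar> \<le> 1" for x
    using e by (simp add: h_def field_simps)
  then have "esssup (lebesgue_on {0..1}) (\<lambda>x. ereal \<bar>h x\<bar>) \<le> 1"
    using h[of "{0..1}"]
    by (intro esssup_I AE_I2)
      (auto simp: one_ereal_def
        intro!: continuous_imp_measurable_on_sets_lebesgue continuous_intros)
  then have "Lp_norm \<infinity> 0 1 h \<le> 1"
    by (cases "esssup (lebesgue_on {0..1}) (\<lambda>x. ereal \<bar>h x\<bar>)")
      (auto simp: Lp_norm_def one_ereal_def)
  then have "c * Lp_norm \<infinity> 0 1 h \<le> c"
    using \<open>0 \<le> c\<close> by (simp add: mult_left_le)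
  also note e(2)
  also have "poly_norm 1 p - e = (LINT x|lebesgue_on {0..1}. \<bar>poly p x\<bar> - e)"
    by (subst Bochner_Integration.integral_diff)
      (auto simp: poly_norm_def measure_restrict_space
        intro!: continuous_imp_integrable_real continuous_intros)
  also have "\<dots> \<le> (LINT x|lebesgue_on {0..1}. poly p x * h x)"
  proof (intro integral_mono continuous_imp_integrable_real continuous_intros h)
    fix x
    have "(\<bar>poly p x\<bar> - e) * (\<bar>poly p x\<bar> + e) \<le> poly p x * poly p x"
      by (simp add: algebra_simps flip: power2_eq_square)
    then show "\<bar>poly p x\<bar> - e \<le> poly p x * h x"
      using e by (simp add: h_def pos_le_divide_eq add_nonneg_pos)
  qed
  finally show ?thesis
    using h by blast
qed

text \<open>This is the equality case of Hoelder's inequality: for this \<open>h\<close> the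
  integral equals the product of the two norms, so any \<open>c\<close> below the norm of
  \<open>p\<close> is beaten.\<close>

lemma poly_norm_sharp_real:
  assumes "0 \<le> c" "c < poly_norm (ereal r) p" and rs: "r > 1" "s > 1" "1 / r + 1 / s = 1"
  shows "\<exists>h. continuous_on UNIV h \<and>
    c * Lp_norm (ereal s) 0 1 h < (LINT x|lebesgue_on {0..1}. poly p x * h x)"
proof -
  define I where "I = (LINT x|lebesgue_on {0..1}. \<bar>poly p x\<bar> powr r)"
  have "I powr (1 / r) > c"
    using assms by (simp add: I_def poly_norm_def)
  moreover have "I \<ge> 0"
    by (simp add: I_def)
  \<comment> \<open>\<open>0 powr (1 / r)\<close> is 0, which cannot exceed \<open>c\<close>.
    Positivity of \<open>I\<close> later keeps the inequality strict after multiplication by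
    \<open>I powr (1 / s)\<close>.\<close>
  ultimately have "I > 0"
    using \<open>0 \<le> c\<close> by (cases "I = 0") auto
  \<comment> \<open>This is \<open>sgn p \<bar>p\<bar>\<^sup>r\<^sup>-\<^sup>1\<close>, written so that continuity is evident.\<close>
  define h where "h = (\<lambda>x. max (poly p x) 0 powr (r - 1) - max (- poly p x) 0 powr (r - 1))"
  have h: "continuous_on UNIV h"
    unfolding h_def using rs by (intro continuous_on_powr' continuous_intros) auto
  have h_sgn: "h x = sgn (poly p x) * \<bar>poly p x\<bar> powr (r - 1)" for x
    by (auto simp: h_def sgn_if max_def)
  have "(r - 1) * s = r"
    using rs by (simp add: field_simps)
  then have "\<bar>h x\<bar> powr s = \<bar>poly p x\<bar> powr r" for x
    using rs by (auto simp: h_sgn abs_mult powr_powr sgn_if)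
  then have norm: "Lp_norm (ereal s) 0 1 h = I powr (1 / s)"
    by (simp add: Lp_norm_def I_def)
  have "poly p x * h x = \<bar>poly p x\<bar> powr r" for x
  proof -
    have "poly p x * h x = (poly p x * sgn (poly p x)) * \<bar>poly p x\<bar> powr (r - 1)"
      by (simp add: h_sgn)
    also have "poly p x * sgn (poly p x) = \<bar>poly p x\<bar>"
      by (simp add: abs_sgn)
    finally show ?thesis
      by (simp add: powr_mult_base)
  qed
  then have "(LINT x|lebesgue_on {0..1}. poly p x * h x) = I"
    by (simp add: I_def)
  also have "I = I powr (1 / r) * I powr (1 / s)"
    using rs \<open>I > 0\<close> by (simp flip: powr_add)
  finally show ?thesis
    using norm h \<open>I powr (1 / r) > c\<close> \<open>I > 0\<close> by (intro exI[of _ h]) simp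
qed

lemma poly_norm_sharp:
  assumes rs: "1 \<le> r" "1 \<le> s" "1 / r + 1 / s = 1" and c: "0 \<le> c" "c < poly_norm r p"
  shows "\<exists>h. continuous_on UNIV h \<and>
    c * Lp_norm s 0 1 h < (LINT x|lebesgue_on {0..1}. poly p x * h x)"
  using rs
proof (cases rule: conjugate_exponents_cases)
  case infinity_one
  then show ?thesis using c poly_norm_sharp_infinity by blast
next
  case one_infinity
  then show ?thesis using c poly_norm_sharp_one by blast
next
  case real
  then show ?thesis using c poly_norm_sharp_real by blast
qed

section \<open>Admissible functions with a prescribed continuous derivative of order
  \<open>n\<close>\<close>

text \<open>Integrate repeatedly. Since \<open>nth_deriv_within\<close> adds its new derivative on
  the outside, the induction replaces the target \<open>g\<close> by its integral \<open>G\<close>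
  and keeps the \<open>f\<close> obtained for \<open>G\<close>.\<close>

lemma ex_nth_antiderivative:
  assumes "a < b" "continuous_on {a..b} g"
  shows "\<exists>f. (\<forall>x\<in>{a..b}. nth_deriv_within {a..b} n f x = g x) \<and>
    (\<forall>k<n. nth_deriv_within {a..b} k f differentiable_on {a..b})"
  using assms(2)
proof (induction n arbitrary: g)
  case 0
  then show ?case
    by (intro exI[of _ g]) simp
next
  case (Suc n)
  define G where "G = (\<lambda>x. integral {a..x} g)"
  have G: "(G has_vector_derivative g x) (at x within {a..b})" if "x \<in> {a..b}" for x
    unfolding G_def using Suc.prems that by (rule integral_has_vector_derivative)
  then have "continuous_on {a..b} G"
    by (meson continuous_on_eq_continuous_within has_vector_derivative_continuous)
  then obtain f where f: "\<And>x. x \<in> {a..b} \<Longrightarrow> nth_deriv_within {a..b} n f x = G x"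
    "\<And>k. k < n \<Longrightarrow> nth_deriv_within {a..b} k f differentiable_on {a..b}"
    using Suc.IH by blast
  \<comment> \<open>Agreement with \<open>G\<close> is known only on \<open>{a..b}\<close>, which
    suffices for derivatives within that set.\<close>
  have deriv: "(nth_deriv_within {a..b} n f has_vector_derivative g x) (at x within {a..b})"
    if "x \<in> {a..b}" for x
    using that G f(1) by (intro has_vector_derivative_transform[OF that _ G[OF that]]) auto
  then have "nth_deriv_within {a..b} n f differentiable_on {a..b}"
    unfolding differentiable_on_def using differentiableI_vector by blast
  moreover have "nth_deriv_within {a..b} (Suc n) f x = g x" if "x \<in> {a..b}" for x
    using vector_derivative_within_closed_interval[OF \<open>a < b\<close> that deriv[OF that]] by simp
  ultimately show ?case
    using f(2) by (intro exI[of _ f]) (auto simp: less_Suc_eq)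
qed

lemma lipschitz_imp_abs_continuous_on_interval:
  assumes "\<And>x y. x \<in> {a..b} \<Longrightarrow> y \<in> {a..b} \<Longrightarrow> \<bar>g y - g x\<bar> \<le> B * \<bar>y - x\<bar>" and "B > 0"
  shows "abs_continuous_on_interval a b g"
  unfolding abs_continuous_on_interval_def
proof (intro allI impI)
  fix \<epsilon> :: real assume "\<epsilon> > 0"
  show "\<exists>\<delta>>0. \<forall>I. finite I \<longrightarrow> (\<forall>(u, v)\<in>I. a \<le> u \<and> u \<le> v \<and> v \<le> b) \<longrightarrow>
      disjoint_family_on (\<lambda>(u, v). {u<..<v}) I \<longrightarrow> (\<Sum>(u, v)\<in>I. v - u) < \<delta> \<longrightarrow>
      (\<Sum>(u, v)\<in>I. \<bar>g v - g u\<bar>) < \<epsilon>"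
  proof (intro exI[of _ "\<epsilon> / B"] conjI allI impI)
    fix I :: "(real \<times> real) set"
    assume I: "\<forall>(u, v)\<in>I. a \<le> u \<and> u \<le> v \<and> v \<le> b" and less: "(\<Sum>(u, v)\<in>I. v - u) < \<epsilon> / B"
    have "(\<Sum>(u, v)\<in>I. \<bar>g v - g u\<bar>) \<le> (\<Sum>(u, v)\<in>I. B * (v - u))"
    proof (rule sum_mono, clarify)
      fix u v assume "(u, v) \<in> I"
      then have "a \<le> u" "u \<le> v" "v \<le> b"
        using I by auto
      then show "\<bar>g v - g u\<bar> \<le> B * (v - u)"
        using assms(1)[of u v] by simp
    qed
    also have "\<dots> = B * (\<Sum>(u, v)\<in>I. v - u)"
      by (simp add: sum_distrib_left case_prod_unfold)
    also have "\<dots> < \<epsilon>"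
      using less \<open>B > 0\<close> by (simp add: field_simps)
    finally show "(\<Sum>(u, v)\<in>I. \<bar>g v - g u\<bar>) < \<epsilon>" .
  qed (use \<open>\<epsilon> > 0\<close> \<open>B > 0\<close> in simp)
qed

text \<open>This reduces sharpness to a question about continuous functions. The derivative of order
  \<open>n - 1\<close> has the bounded derivative \<open>g\<close>, so it is Lipschitz by the mean
  value inequality and hence absolutely continuous.\<close>

lemma ex_admissible_nth_deriv:
  assumes "a < b" "n \<ge> 1" "1 \<le> s" and g: "continuous_on {a..b} g"
  shows "\<exists>f. admissible n s a b f \<and> (\<forall>x\<in>{a..b}. nth_deriv_within {a..b} n f x = g x)"
proof -
  obtain f where f: "\<And>x. x \<in> {a..b} \<Longrightarrow> nth_deriv_within {a..b} n f x = g x"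
    "\<And>k. k < n \<Longrightarrow> nth_deriv_within {a..b} k f differentiable_on {a..b}"
    using ex_nth_antiderivative[OF \<open>a < b\<close> g] by blast
  define F where "F = nth_deriv_within {a..b} (n - 1) f"
  have "nth_deriv_within {a..b} n f = (\<lambda>x. vector_derivative F (at x within {a..b}))"
    using \<open>n \<ge> 1\<close> by (cases n) (auto simp: F_def)
  moreover have "F differentiable_on {a..b}"
    using f(2)[of "n - 1"] \<open>n \<ge> 1\<close> by (simp add: F_def)
  ultimately have F: "(F has_vector_derivative g x) (at x within {a..b})" if "x \<in> {a..b}" for x
    using f(1)[OF that] that unfolding differentiable_on_def vector_derivative_works by metis
  obtain B where B: "B > 0" "\<And>x. x \<in> {a..b} \<Longrightarrow> \<bar>g x\<bar> \<le> B"
    using compact_imp_bounded[OF compact_continuous_image[OF g]] by (auto simp: bounded_pos)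
  have "\<bar>F y - F x\<bar> \<le> B * \<bar>y - x\<bar>" if "x \<in> {a..b}" "y \<in> {a..b}" for x y
    using field_differentiable_bound[of "{a..b}" F g B y x] F B that
    by (auto simp: has_real_derivative_iff_has_vector_derivative)
  then have "abs_continuous_on_interval a b F"
    using B by (intro lipschitz_imp_abs_continuous_on_interval)
  then have "admissible n s a b f"
    using f continuous_on_imp_in_Lp[OF g \<open>1 \<le> s\<close>] in_Lp_cong[OF f(1)]
    by (auto simp: admissible_def F_def)
  then show ?thesis
    using f by blast
qed

section \<open>The bound and its sharpness on a general interval\<close>

theorem proposition4p1:
  fixes n :: nat and a b :: real and p :: "real poly" and r s :: ereal
  assumes "n \<ge> 1"
    and "a < b"
    and "degree p = n"
    and "lead_coeff p = 1 / fact n"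
    and "1 \<le> r" and "1 \<le> s"
    and "1 / r + 1 / s = 1"
  shows "(\<forall>f. admissible n s a b f \<longrightarrow>
            \<bar>error_term n a b p f\<bar>
              \<le> (b - a) powr (real n + real_of_ereal (1 / r)) * poly_norm r p
                * Lp_norm s a b (nth_deriv_within {a..b} n f))
       \<and> \<not> (\<exists>C. C < (b - a) powr (real n + real_of_ereal (1 / r)) * poly_norm r p \<and>
              (\<forall>f. admissible n s a b f \<longrightarrow>
                 \<bar>error_term n a b p f\<bar>
                   \<le> C * Lp_norm s a b (nth_deriv_within {a..b} n f)))"
proof -
  note rs = \<open>1 \<le> r\<close> \<open>1 \<le> s\<close> \<open>1 / r + 1 / s = 1\<close>
  define \<alpha> \<beta> where "\<alpha> = real_of_ereal (1 / r)" and "\<beta> = real_of_ereal (1 / s)"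
  have "\<alpha> + \<beta> = 1"
    using rs by (cases rule: conjugate_exponents_cases) (auto simp: \<alpha>_def \<beta>_def one_ereal_def)
  then have sum: "real (n + 1) = (real n + \<alpha>) + \<beta>"
    by simp
  \<comment> \<open>The split isolates the factor with exponent \<open>\<beta>\<close>, the very one
    that the change of variables produces in the \<open>s\<close>-norm; what remains is the constant
    \<open>K\<close>.\<close>
  have pow: "(b - a) ^ (n + 1) = (b - a) powr (real n + \<alpha>) * (b - a) powr \<beta>"
    using \<open>a < b\<close> powr_realpow[of "b - a" "n + 1"] unfolding sum by (simp add: powr_add)
  define K where "K = (b - a) powr (real n + \<alpha>)"
  have pos: "K > 0" "(b - a) powr \<beta> > 0"
    using \<open>a < b\<close> by (simp_all add: K_def)
  define H where "H f x = nth_deriv_within {a..b} n f (a + (b - a) * x)" for f x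
  have err: "\<bar>error_term n a b p f\<bar> =
      K * (b - a) powr \<beta> * \<bar>LINT x|lebesgue_on {0..1}. poly p x * H f x\<bar>" for f
    using \<open>a < b\<close> unfolding error_term_def pow by (simp add: abs_mult K_def H_def)
  have norm: "Lp_norm s a b (nth_deriv_within {a..b} n f) = (b - a) powr \<beta> * Lp_norm s 0 1 (H f)"
    and Lp: "in_Lp s 0 1 (H f)" if "admissible n s a b f" for f
    using that Lp_norm_affine[OF \<open>a < b\<close> \<open>1 \<le> s\<close>] in_Lp_affine[OF \<open>a < b\<close> \<open>1 \<le> s\<close>]
    unfolding admissible_def H_def \<beta>_def by (auto simp: in_Lp_def)
  have upper: "\<bar>error_term n a b p f\<bar> \<le>
      K * poly_norm r p * Lp_norm s a b (nth_deriv_within {a..b} n f)"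
    if "admissible n s a b f" for f
  proof -
    have "\<bar>error_term n a b p f\<bar> \<le> K * (b - a) powr \<beta> * (poly_norm r p * Lp_norm s 0 1 (H f))"
      unfolding err using pos poly_norm_Holder[OF rs Lp[OF that]] by (intro mult_left_mono) auto
    then show ?thesis
      by (simp add: norm[OF that] mult_ac)
  qed
  have sharp: False if C: "C < K * poly_norm r p" and le: "\<And>f. admissible n s a b f \<Longrightarrow>
      \<bar>error_term n a b p f\<bar> \<le> C * Lp_norm s a b (nth_deriv_within {a..b} n f)" for C
  proof -
    \<comment> \<open>The assumed inequality is carried back to the unit interval, where it holds
      for every continuous \<open>h\<close>: the factor \<open>(b - a) powr \<beta>\<close> is on
      both sides and cancels.\<close>
    have bound: "K * \<bar>LINT x|lebesgue_on {0..1}. poly p x * h x\<bar> \<le> C * Lp_norm s 0 1 h"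
      if h: "continuous_on UNIV h" for h
    proof -
      have "continuous_on {a..b} (\<lambda>y. h ((y - a) / (b - a)))"
        using \<open>a < b\<close> by (intro continuous_on_compose2[OF h] continuous_intros) auto
      then obtain f where f: "admissible n s a b f"
        "\<And>y. y \<in> {a..b} \<Longrightarrow> nth_deriv_within {a..b} n f y = h ((y - a) / (b - a))"
        using ex_admissible_nth_deriv \<open>a < b\<close> \<open>n \<ge> 1\<close> \<open>1 \<le> s\<close> by blast
      have Hf: "H f x = h x" if "x \<in> {0..1}" for x
        using that \<open>a < b\<close> measurable_space[OF lebesgue_on_affine(1)[OF \<open>a < b\<close>], of x]
        unfolding H_def by (subst f(2)) auto
      have "(LINT x|lebesgue_on {0..1}. poly p x * H f x) = (LINT x|lebesgue_on {0..1}. poly p x * h x)"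
        using Hf by (intro Bochner_Integration.integral_cong) auto
      then show ?thesis
        using le[OF f(1)] norm[OF f(1)] err[of f] Lp_norm_cong[OF Hf, where s = s] pos
        by (simp add: mult_ac)
    qed
    \<comment> \<open>A negative \<open>C\<close> is ruled out by \<open>h = 1\<close>.\<close>
    have "0 \<le> K * \<bar>LINT x|lebesgue_on {0..1}. poly p x * 1\<bar>"
      using pos by simp
    also have "\<dots> \<le> C"
      using bound[of "\<lambda>_. 1"] Lp_norm_one[OF \<open>1 \<le> s\<close>] by simp
    \<comment> \<open>Division by \<open>K\<close> makes the constant comparable with
      \<open>poly_norm r p\<close>, so a near-extremiser for \<open>C / K\<close> contradicts
      \<open>bound\<close>.\<close>
    finally have "0 \<le> C / K" "C / K < poly_norm r p"
      using C pos by (simp_all add: field_simps)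
    then obtain h where h: "continuous_on UNIV h"
      "C / K * Lp_norm s 0 1 h < (LINT x|lebesgue_on {0..1}. poly p x * h x)"
      using poly_norm_sharp[OF rs] by blast
    from h(2) have "C * Lp_norm s 0 1 h < K * (LINT x|lebesgue_on {0..1}. poly p x * h x)"
      using pos by (simp add: field_simps)
    also have "\<dots> \<le> K * \<bar>LINT x|lebesgue_on {0..1}. poly p x * h x\<bar>"
      using pos by simp
    finally show False
      using bound[OF h(1)] by simp
  qed
  show ?thesis
    using upper sharp unfolding K_def \<alpha>_def by blast
qed

end
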